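(* Let $1<p\le 2$ and let $(w_k)_{k\in\mathbf{N}}$ satisfy $w_k\ge w_0>0$ for all $k$. Let $u^+\in\ell^2$ with $Ku^+=g^+$, and suppose that $u^+$ fulfills the source condition: there exists $\theta\in Y$ such that $$ w\,\operatorname{sgn}(u^+)\,|u^+|^{p-1} = K^*\theta, $$ i.e. $w_k\operatorname{sgn}(u^+_k)|u^+_k|^{p-1}=(K^*\theta)_k$ for all $k$. For $\delta>0$ let $g^\delta\in Y$ with $\|g^+-g^\delta\|_Y\le\delta$, and let $u^{\alpha,\delta}$ be a minimizer over $u\in\ell^2$ of $$\Psi(u)=\|Ku-g^\delta\|_Y^2+\alpha\sum_k w_k|u_k|^p .$$ Then for the choice $\alpha=\alpha(\delta)\sim\delta$ it holds $$\|Ku^{\alpha,\delta}-g^\delta\|_Y=\mathcal{O}(\delta)\quad\text{for }\delta\to0,$$ $$\sum_k w_k|u^{\alpha,\delta}_k-u^+_k|^2=\mathcal{O}(\delta)\quad\text{for }\delta\to0.$$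
   Context: $Y$ is a real Hilbert space, $\ell^2$ is the space of real square-summable sequences indexed by $\mathbf{N}$, and $K:\ell^2\to Y$ is a bounded linear operator with Hilbert space adjoint $K^*:Y\to\ell^2$. $g^+\in Y$ is the exact data, $g^\delta\in Y$ the noisy data, $\alpha>0$ the regularization parameter. $\Psi$ takes the value $+\infty$ where the penalty sum diverges. $\operatorname{sgn}$ is the usual sign with $\operatorname{sgn}(0)=0$; operations on sequences are component-wise. $\alpha\sim\delta$ means that there are constants $0<c\le C$ with $c\,\delta\le\alpha(\delta)\le C\,\delta$ for all small $\delta$. *)

theory Defs
  imports "HOL-Analysis.Analysis" "HOL-Library.Landau_Symbols"
begin

typedef ell2 = "{x :: nat \<Rightarrow> real. summable (\<lambda>k. (x k)\<^sup>2)}"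
  morphisms ell2_nth Abs_ell2
  by (rule exI[of _ "\<lambda>_. 0"]) simp

setup_lifting type_definition_ell2

lemma ell2_eqI: "(\<And>k. ell2_nth x k = ell2_nth y k) \<Longrightarrow> x = y"
  by (metis ell2_nth_inject ext)

lemma square_summable_mult:
  fixes x y :: "nat \<Rightarrow> real"
  assumes "summable (\<lambda>k. (x k)\<^sup>2)" "summable (\<lambda>k. (y k)\<^sup>2)"
  shows "summable (\<lambda>k. x k * y k)"
proof (rule summable_comparison_test')
  show "summable (\<lambda>k. (x k)\<^sup>2 + (y k)\<^sup>2)"
    using assms by (rule summable_add)
  fix k
  have "2 * \<bar>x k\<bar> * \<bar>y k\<bar> \<le> (x k)\<^sup>2 + (y k)\<^sup>2"
    using sum_squares_bound[of "\<bar>x k\<bar>" "\<bar>y k\<bar>"] by simp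
  moreover have "0 \<le> \<bar>x k\<bar> * \<bar>y k\<bar>" by simp
  ultimately show "norm (x k * y k) \<le> (x k)\<^sup>2 + (y k)\<^sup>2"
    unfolding real_norm_def abs_mult by linarith
qed

lemma square_summable_add:
  fixes x y :: "nat \<Rightarrow> real"
  assumes "summable (\<lambda>k. (x k)\<^sup>2)" "summable (\<lambda>k. (y k)\<^sup>2)"
  shows "summable (\<lambda>k. (x k + y k)\<^sup>2)"
proof -
  have "summable (\<lambda>k. (x k)\<^sup>2 + (y k)\<^sup>2 + 2 * (x k * y k))"
    by (intro summable_add summable_mult assms square_summable_mult)
  then show ?thesis by (simp add: power2_sum algebra_simps)
qed

lemma summable_ell2_nth: "summable (\<lambda>k. (ell2_nth x k)\<^sup>2)"
  using ell2_nth[of x] by simp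

lemma summable_ell2_nth_mult: "summable (\<lambda>k. ell2_nth x k * ell2_nth y k)"
  by (intro square_summable_mult summable_ell2_nth)

instantiation ell2 :: real_vector
begin

lift_definition zero_ell2 :: ell2 is "\<lambda>_. 0" by simp

lift_definition plus_ell2 :: "ell2 \<Rightarrow> ell2 \<Rightarrow> ell2" is "\<lambda>x y k. x k + y k"
  by (rule square_summable_add)

lift_definition uminus_ell2 :: "ell2 \<Rightarrow> ell2" is "\<lambda>x k. - x k" by simp

lift_definition scaleR_ell2 :: "real \<Rightarrow> ell2 \<Rightarrow> ell2" is "\<lambda>r x k. r * x k"
  by (simp add: power_mult_distrib summable_mult)

definition minus_ell2 :: "ell2 \<Rightarrow> ell2 \<Rightarrow> ell2" where "minus_ell2 x y = x + - y"

instance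
  by standard
    (rule ell2_eqI, simp add: minus_ell2_def zero_ell2.rep_eq plus_ell2.rep_eq
      uminus_ell2.rep_eq scaleR_ell2.rep_eq algebra_simps)+

end

lemma ell2_nth_zero [simp]: "ell2_nth 0 k = 0"
  by (simp add: zero_ell2.rep_eq)

lemma ell2_nth_add [simp]: "ell2_nth (x + y) k = ell2_nth x k + ell2_nth y k"
  by (simp add: plus_ell2.rep_eq)

lemma ell2_nth_uminus [simp]: "ell2_nth (- x) k = - ell2_nth x k"
  by (simp add: uminus_ell2.rep_eq)

lemma ell2_nth_diff [simp]: "ell2_nth (x - y) k = ell2_nth x k - ell2_nth y k"
  unfolding minus_ell2_def ell2_nth_add ell2_nth_uminus by (rule add_uminus_conv_diff)

lemma ell2_nth_scaleR [simp]: "ell2_nth (r *\<^sub>R x) k = r * ell2_nth x k"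
  by (simp add: scaleR_ell2.rep_eq)

instantiation ell2 :: real_inner
begin

definition inner_ell2 :: "ell2 \<Rightarrow> ell2 \<Rightarrow> real" where
  "inner_ell2 x y = (\<Sum>k. ell2_nth x k * ell2_nth y k)"

definition norm_ell2 :: "ell2 \<Rightarrow> real" where
  "norm_ell2 x = sqrt (\<Sum>k. (ell2_nth x k)\<^sup>2)"

definition sgn_ell2 :: "ell2 \<Rightarrow> ell2" where
  "sgn_ell2 x = inverse (norm x) *\<^sub>R x"

definition dist_ell2 :: "ell2 \<Rightarrow> ell2 \<Rightarrow> real" where
  "dist_ell2 x y = norm (x - y)"

definition uniformity_ell2 :: "(ell2 \<times> ell2) filter" where
  "uniformity_ell2 = (INF e\<in>{0<..}. principal {(x, y). dist x y < e})"

definition open_ell2 :: "ell2 set \<Rightarrow> bool" where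
  "open_ell2 U \<longleftrightarrow> (\<forall>x\<in>U. eventually (\<lambda>(x', y). x' = x \<longrightarrow> y \<in> U) uniformity)"

instance
proof
  fix x y z :: ell2 and r :: real and U :: "ell2 set"
  show "inner x y = inner y x"
    by (simp add: inner_ell2_def mult.commute)
  show "inner (x + y) z = inner x z + inner y z"
    by (simp add: inner_ell2_def distrib_right suminf_add summable_ell2_nth_mult)
  show "inner (r *\<^sub>R x) y = r * inner x y"
    by (simp add: inner_ell2_def mult.assoc suminf_mult summable_ell2_nth_mult)
  show "0 \<le> inner x x"
    unfolding inner_ell2_def by (intro suminf_nonneg summable_ell2_nth_mult) simp
  have "inner x x = 0 \<longleftrightarrow> (\<forall>k. ell2_nth x k * ell2_nth x k = 0)"
    unfolding inner_ell2_def by (intro suminf_eq_zero_iff summable_ell2_nth_mult) simp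
  then show "inner x x = 0 \<longleftrightarrow> x = 0"
    by (auto intro: ell2_eqI)
  show "norm x = sqrt (inner x x)"
    by (simp add: norm_ell2_def inner_ell2_def power2_eq_square)
qed (simp_all add: sgn_ell2_def dist_ell2_def uniformity_ell2_def open_ell2_def)

end

lemma sum_ell2_nth_le: "(\<Sum>k<n. (ell2_nth x k)\<^sup>2) \<le> (norm x)\<^sup>2"
proof -
  have "(\<Sum>k<n. (ell2_nth x k)\<^sup>2) \<le> (\<Sum>k. (ell2_nth x k)\<^sup>2)"
    by (rule sum_le_suminf[OF summable_ell2_nth]) auto
  then show ?thesis
    by (simp add: norm_ell2_def suminf_nonneg summable_ell2_nth)
qed

lemma abs_ell2_nth_le: "\<bar>ell2_nth x k\<bar> \<le> norm x"
proof -
  have "(ell2_nth x k)\<^sup>2 \<le> (\<Sum>j<Suc k. (ell2_nth x j)\<^sup>2)"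
    by (simp add: sum_nonneg)
  also have "\<dots> \<le> (norm x)\<^sup>2" by (rule sum_ell2_nth_le)
  finally show ?thesis by (simp add: power2_le_iff_abs_le)
qed

instance ell2 :: complete_space
proof
  fix X :: "nat \<Rightarrow> ell2"
  assume X: "Cauchy X"
  have "Cauchy (\<lambda>n. ell2_nth (X n) k)" for k
  proof (rule metric_CauchyI)
    fix e :: real assume "0 < e"
    then obtain M where M: "\<And>m n. m \<ge> M \<Longrightarrow> n \<ge> M \<Longrightarrow> dist (X m) (X n) < e"
      using metric_CauchyD[OF X] by blast
    have "dist (ell2_nth (X m) k) (ell2_nth (X n) k) < e" if "m \<ge> M" "n \<ge> M" for m n
      using abs_ell2_nth_le[of "X m - X n" k] M[OF that] by (simp add: dist_norm)
    then show "\<exists>M. \<forall>m\<ge>M. \<forall>n\<ge>M. dist (ell2_nth (X m) k) (ell2_nth (X n) k) < e" by blast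
  qed
  then have "convergent (\<lambda>n. ell2_nth (X n) k)" for k
    by (intro real_Cauchy_convergent)
  then have lim: "(\<lambda>n. ell2_nth (X n) k) \<longlonglongrightarrow> lim (\<lambda>n. ell2_nth (X n) k)" for k
    by (simp add: convergent_LIMSEQ_iff)
  define l where "l k = lim (\<lambda>n. ell2_nth (X n) k)" for k
  have l: "(\<lambda>n. ell2_nth (X n) k) \<longlonglongrightarrow> l k" for k
    unfolding l_def by (rule lim)
  have tail: "\<exists>M. \<forall>m\<ge>M. \<forall>N. (\<Sum>k<N. (ell2_nth (X m) k - l k)\<^sup>2) \<le> e\<^sup>2" if "0 < e" for e :: real
  proof -
    obtain M where M: "\<And>m n. m \<ge> M \<Longrightarrow> n \<ge> M \<Longrightarrow> dist (X m) (X n) < e"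
      using metric_CauchyD[OF X \<open>0 < e\<close>] by blast
    have "(\<Sum>k<N. (ell2_nth (X m) k - l k)\<^sup>2) \<le> e\<^sup>2" if m: "m \<ge> M" for m N
    proof (rule LIMSEQ_le_const2)
      show "(\<lambda>n. \<Sum>k<N. (ell2_nth (X m) k - ell2_nth (X n) k)\<^sup>2)
              \<longlonglongrightarrow> (\<Sum>k<N. (ell2_nth (X m) k - l k)\<^sup>2)"
        by (intro tendsto_intros l)
      have "(\<Sum>k<N. (ell2_nth (X m) k - ell2_nth (X n) k)\<^sup>2) \<le> e\<^sup>2" if "n \<ge> M" for n
      proof -
        have "(\<Sum>k<N. (ell2_nth (X m) k - ell2_nth (X n) k)\<^sup>2) \<le> (norm (X m - X n))\<^sup>2"
          using sum_ell2_nth_le[where x = "X m - X n" and n = N] by simp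
        also have "\<dots> \<le> e\<^sup>2"
          using M[OF m that] by (intro power_mono) (auto simp: dist_norm)
        finally show ?thesis .
      qed
      then show "\<exists>M. \<forall>n\<ge>M. (\<Sum>k<N. (ell2_nth (X m) k - ell2_nth (X n) k)\<^sup>2) \<le> e\<^sup>2" by blast
    qed
    then show ?thesis by blast
  qed
  have diff: "summable (\<lambda>k. (ell2_nth (X m) k - l k)\<^sup>2)"
    if "\<forall>N. (\<Sum>k<N. (ell2_nth (X m) k - l k)\<^sup>2) \<le> c" for m c
    using that by (intro summableI_nonneg_bounded[where x = c]) auto
  obtain m0 where "\<forall>N. (\<Sum>k<N. (ell2_nth (X m0) k - l k)\<^sup>2) \<le> 1\<^sup>2"
    using tail[of 1] by auto
  then have "summable (\<lambda>k. (l k - ell2_nth (X m0) k)\<^sup>2)"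
    using diff by (simp add: power2_commute)
  then have "summable (\<lambda>k. (l k - ell2_nth (X m0) k + ell2_nth (X m0) k)\<^sup>2)"
    by (rule square_summable_add[OF _ summable_ell2_nth])
  then have sl: "summable (\<lambda>k. (l k)\<^sup>2)" by simp
  define L where "L = Abs_ell2 l"
  have L: "ell2_nth L k = l k" for k
    using sl by (simp add: L_def Abs_ell2_inverse)
  have "X \<longlonglongrightarrow> L"
  proof (rule metric_LIMSEQ_I)
    fix r :: real assume "0 < r"
    then obtain M where M: "\<And>m N. m \<ge> M \<Longrightarrow> (\<Sum>k<N. (ell2_nth (X m) k - l k)\<^sup>2) \<le> (r / 2)\<^sup>2"
      using tail[of "r / 2"] by auto
    have "dist (X m) L < r" if "m \<ge> M" for m
    proof -
      have "(\<Sum>k. (ell2_nth (X m) k - l k)\<^sup>2) \<le> (r / 2)\<^sup>2"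
        using M[OF that] by (intro suminf_le_const diff) auto
      then have "dist (X m) L \<le> r / 2"
        unfolding dist_norm norm_ell2_def ell2_nth_diff L
        using \<open>0 < r\<close> by (intro real_le_lsqrt) auto
      then show ?thesis using \<open>0 < r\<close> by simp
    qed
    then show "\<exists>no. \<forall>n\<ge>no. dist (X n) L < r" by blast
  qed
  then show "convergent X" by (auto simp: convergent_def)
qed

text \<open>
  \<^const>\<open>adjoint\<close> is defined by a choice operator, and the library proves its defining property
  only for finite-dimensional spaces. The following lemmas establish it for bounded operators
  on \<^typ>\<open>ell2\<close>.
\<close>

lift_definition ell2_unit :: "nat \<Rightarrow> ell2" is "\<lambda>j k. if k = j then 1 else 0"
  by (rule summable_finite[of "{j}" for j]) auto

lemma ell2_nth_sum: "ell2_nth (sum f A) k = (\<Sum>j\<in>A. ell2_nth (f j) k)"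
  by (induction A rule: infinite_finite_induct) auto

lemma ell2_nth_partial:
  "ell2_nth (\<Sum>j<n. a j *\<^sub>R ell2_unit j) k = (if k < n then a k else 0)"
  by (simp add: ell2_nth_sum ell2_unit.rep_eq if_distrib cong: if_cong)

lemma norm_partial:
  "(norm (\<Sum>j<n. a j *\<^sub>R ell2_unit j))\<^sup>2 = (\<Sum>j<n. (a j)\<^sup>2)"
proof -
  have "(\<Sum>k. (ell2_nth (\<Sum>j<n. a j *\<^sub>R ell2_unit j) k)\<^sup>2)
      = (\<Sum>k<n. (ell2_nth (\<Sum>j<n. a j *\<^sub>R ell2_unit j) k)\<^sup>2)"
    by (rule suminf_finite) (auto simp: ell2_nth_partial)
  also have "\<dots> = (\<Sum>j<n. (a j)\<^sup>2)"
    by (rule sum.cong) (auto simp: ell2_nth_partial)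
  finally show ?thesis
    by (simp add: norm_ell2_def sum_nonneg)
qed

lemma ell2_expansion: "(\<lambda>j. ell2_nth x j *\<^sub>R ell2_unit j) sums x"
proof -
  define P where "P n = (\<Sum>j<n. ell2_nth x j *\<^sub>R ell2_unit j)" for n
  have dist: "(norm (P n - x))\<^sup>2 = (\<Sum>k. (ell2_nth x k)\<^sup>2) - (\<Sum>k<n. (ell2_nth x k)\<^sup>2)" for n
  proof -
    have "(norm (P n - x))\<^sup>2 = (\<Sum>k. (ell2_nth (P n - x) k)\<^sup>2)"
      by (simp add: norm_ell2_def suminf_nonneg summable_ell2_nth del: ell2_nth_diff)
    also have "\<dots> = (\<Sum>k. (ell2_nth x k)\<^sup>2 - (if k < n then (ell2_nth x k)\<^sup>2 else 0))"
      by (intro arg_cong[where f = suminf] ext) (simp add: P_def ell2_nth_partial)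
    also have "\<dots> = (\<Sum>k. (ell2_nth x k)\<^sup>2) - (\<Sum>k. if k < n then (ell2_nth x k)\<^sup>2 else 0)"
      by (intro suminf_diff[symmetric] summable_ell2_nth summable_finite[of "{..<n}"]) auto
    also have "(\<Sum>k. if k < n then (ell2_nth x k)\<^sup>2 else 0) = (\<Sum>k<n. (ell2_nth x k)\<^sup>2)"
      by (subst suminf_finite[of "{..<n}"]) auto
    finally show ?thesis .
  qed
  have "(\<lambda>n. (norm (P n - x))\<^sup>2) \<longlonglongrightarrow> (\<Sum>k. (ell2_nth x k)\<^sup>2) - (\<Sum>k. (ell2_nth x k)\<^sup>2)"
    unfolding dist by (intro tendsto_intros summable_LIMSEQ summable_ell2_nth)
  then have "(\<lambda>n. sqrt ((norm (P n - x))\<^sup>2)) \<longlonglongrightarrow> sqrt 0"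
    by (intro tendsto_real_sqrt) simp
  then have "(\<lambda>n. norm (P n - x)) \<longlonglongrightarrow> 0" by simp
  then show ?thesis
    unfolding sums_def P_def[symmetric] by (simp add: LIM_zero_iff tendsto_norm_zero_iff)
qed

lemma ell2_adjoint_works:
  fixes K :: "ell2 \<Rightarrow> 'a::real_inner"
  assumes "bounded_linear K"
  shows "inner x (adjoint K y) = inner (K x) y"
proof -
  interpret K: bounded_linear K by fact
  obtain B where B: "B \<ge> 0" "\<And>x. norm (K x) \<le> norm x * B"
    using K.nonneg_bounded by blast
  define a where "a y j = inner (K (ell2_unit j)) y" for y j
  have sa: "summable (\<lambda>j. (a y j)\<^sup>2)" for y
  proof (rule summableI_nonneg_bounded)
    fix n
    define z where "z = (\<Sum>j<n. a y j *\<^sub>R ell2_unit j)"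
    have z: "(norm z)\<^sup>2 = (\<Sum>j<n. (a y j)\<^sup>2)"
      unfolding z_def by (rule norm_partial)
    have "(norm z)\<^sup>2 = inner (K z) y"
      unfolding z unfolding z_def
      by (simp add: K.sum K.scaleR inner_sum_left a_def power2_eq_square)
    also have "\<dots> \<le> norm (K z) * norm y" by (rule norm_cauchy_schwarz)
    also have "\<dots> \<le> norm z * (B * norm y)"
      using mult_right_mono[OF B(2)[of z] norm_ge_zero[of y]] by (simp add: mult.assoc)
    finally have "norm z \<le> B * norm y"
      using B(1) by (cases "norm z = 0") (auto simp: power2_eq_square)
    then show "(\<Sum>j<n. (a y j)\<^sup>2) \<le> (B * norm y)\<^sup>2"
      unfolding z[symmetric] by (intro power_mono) auto
  qed simp
  have "inner (K x) y = inner x (Abs_ell2 (a y))" for x y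
  proof -
    have "(\<lambda>j. inner (K (ell2_nth x j *\<^sub>R ell2_unit j)) y) sums inner (K x) y"
      by (intro bounded_linear.sums[OF bounded_linear_inner_left] K.sums ell2_expansion)
    then have "inner (K x) y = (\<Sum>j. ell2_nth x j * a y j)"
      by (simp add: K.scaleR a_def sums_iff)
    then show ?thesis
      using sa[of y] by (simp add: inner_ell2_def Abs_ell2_inverse)
  qed
  then have "\<exists>f'. \<forall>x y. inner (K x) y = inner x (f' y)"
    by (intro exI[of _ "\<lambda>y. Abs_ell2 (a y)"]) simp
  then have "\<forall>x y. inner (K x) y = inner x (adjoint K y)"
    unfolding adjoint_def by (rule someI_ex)
  then show ?thesis by simp
qed

text \<open>
  For nonnegative weights the terms of the penalty are nonnegative, so the sum diverges exactly
  when the terms are not summable. Note that \<open>0 powr p = 0\<close>.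
\<close>

definition tikhonov ::
  "(ell2 \<Rightarrow> 'a::real_inner) \<Rightarrow> (nat \<Rightarrow> real) \<Rightarrow> real \<Rightarrow> real \<Rightarrow> 'a \<Rightarrow> ell2 \<Rightarrow> ereal" where
  "tikhonov K w p \<alpha> g u =
     (if summable (\<lambda>k. w k * \<bar>ell2_nth u k\<bar> powr p)
      then ereal ((norm (K u - g))\<^sup>2 + \<alpha> * (\<Sum>k. w k * \<bar>ell2_nth u k\<bar> powr p))
      else \<infinity>)"

end

theory Submission
  imports Defs
begin

text \<open>
  Comparing a minimizer \<open>u\<close> with \<open>u_plus\<close> bounds the penalty of \<open>u\<close> by a constant, because
  \<open>\<delta>\<^sup>2 / \<alpha>\<close> stays bounded; since \<open>w\<close> is bounded below, all coordinates of \<open>u\<close> and \<open>u_plus\<close>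
  then lie in a fixed interval \<open>[-M, M]\<close>. On this interval the second derivative of
  \<open>\<bar>x\<bar> powr p\<close> is bounded below by a positive constant (here \<open>p \<le> 2\<close> enters), so the Bregman
  distance of the penalty dominates the weighted squared distance. The linear term of the
  Bregman distance is \<open>p\<close> times the inner product of \<open>\<theta>\<close> and \<open>K (u - u_plus)\<close> by the source
  condition, hence is controlled by the residual, and minimality yields a quadratic inequality
  for the residual.
\<close>

section \<open>Convexity estimates for \<open>\<bar>x\<bar> powr p\<close> on the real line\<close>

lemma has_real_derivative_abs_powr:
  fixes x p :: real
  assumes "1 < p"
  shows "((\<lambda>x. \<bar>x\<bar> powr p) has_real_derivative p * (sgn x * \<bar>x\<bar> powr (p - 1))) (at x)"
proof (cases "x = 0")
  case True
  \<comment> \<open>At the origin the difference quotient has absolute value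
    \<open>\<bar>h\<bar> powr (p - 1)\<close>, which tends to 0 because
    \<open>1 < p\<close>.\<close>
  have "((\<lambda>h. \<bar>h::real\<bar> powr (p - 1)) \<longlongrightarrow> 0) (at 0)"
    using assms by (auto intro!: tendsto_eq_intros tendsto_zero_powrI)
  moreover have "\<bar>\<bar>h\<bar> powr p / h\<bar> = \<bar>h\<bar> powr (p - 1)" if "h \<noteq> 0" for h :: real
    using that by (simp add: powr_diff)
  ultimately have "((\<lambda>h. \<bar>\<bar>h::real\<bar> powr p / h\<bar>) \<longlongrightarrow> 0) (at 0)"
    by (subst tendsto_cong[where g = "\<lambda>h. \<bar>h\<bar> powr (p - 1)"])
      (auto simp: eventually_at intro!: exI[of _ 1])
  then have "((\<lambda>h. \<bar>h::real\<bar> powr p / h) \<longlongrightarrow> 0) (at 0)"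
    by (rule tendsto_rabs_zero_cancel)
  then show ?thesis
    using True assms by (simp add: has_field_derivative_iff)
next
  case False
  then consider "0 < x" | "x < 0" by linarith
  then show ?thesis
  proof cases
    case 1
    then have "((\<lambda>x. x powr p) has_real_derivative p * (sgn x * \<bar>x\<bar> powr (p - 1))) (at x)"
      by (auto intro!: derivative_eq_intros)
    then show ?thesis
      by (rule has_field_derivative_transform_within_open[where S = "{0<..}"]) (use 1 in auto)
  next
    case 2
    then have "((\<lambda>x. (- x) powr p) has_real_derivative p * (sgn x * \<bar>x\<bar> powr (p - 1))) (at x)"
      by (auto intro!: derivative_eq_intros)
    then show ?thesis
      by (rule has_field_derivative_transform_within_open[where S = "{..<0}"]) (use 2 in auto)
  qed
qed

text \<open>Since \<open>q - 1 \<le> 0\<close>, the slope \<open>q * t powr (q - 1)\<close>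
  decreases in \<open>t\<close> and so stays above its value at \<open>M\<close>. Only interior
  derivatives and continuity up to the endpoints enter, which covers \<open>x = 0\<close>, where the
  slope blows up for \<open>q < 1\<close>.\<close>

lemma powr_diff_ge:
  fixes x y q M :: real
  assumes "0 < q" "q \<le> 1" "0 \<le> x" "x \<le> y" "y \<le> M"
  shows "q * M powr (q - 1) * (y - x) \<le> y powr q - x powr q"
proof (cases "x = y")
  case False
  let ?h = "\<lambda>t. t powr q - q * M powr (q - 1) * t"
  have "?h x \<le> ?h y"
  proof (rule DERIV_nonneg_imp_increasing_open[OF \<open>x \<le> y\<close>])
    fix t assume t: "x < t" "t < y"
    have "(?h has_real_derivative q * t powr (q - 1) - q * M powr (q - 1)) (at t)"
      using t assms by (auto intro!: derivative_eq_intros)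
    moreover have "M powr (q - 1) \<le> t powr (q - 1)"
      using t assms by (intro powr_mono2') auto
    ultimately show "\<exists>d. (?h has_real_derivative d) (at t) \<and> 0 \<le> d"
      using assms by (intro exI[of _ "q * t powr (q - 1) - q * M powr (q - 1)"]) auto
  next
    show "continuous_on {x..y} ?h"
      using assms by (intro continuous_intros continuous_on_powr') auto
  qed
  then show ?thesis by (simp add: algebra_simps)
qed simp

text \<open>On either side of 0 this is \<open>powr_diff_ge\<close>, after reflection on the
  negative side; across 0 the estimates on \<open>[x, 0]\<close> and \<open>[0, y]\<close> add up.
  With \<open>q = p - 1\<close> it gives strong monotonicity of the derivative of
  \<open>\<bar>x\<bar> powr p\<close>.\<close>

lemma sgn_powr_diff_ge:
  fixes x y q M :: real
  assumes "0 < q" "q \<le> 1" "x \<le> y" "\<bar>x\<bar> \<le> M" "\<bar>y\<bar> \<le> M"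
  shows "q * M powr (q - 1) * (y - x) \<le> sgn y * \<bar>y\<bar> powr q - sgn x * \<bar>x\<bar> powr q"
proof -
  have pos: "q * M powr (q - 1) * t \<le> t powr q" if "0 \<le> t" "t \<le> M" for t
    using powr_diff_ge[of q 0 t M] assms that by simp
  consider "0 \<le> x" | "y \<le> 0" | "x < 0" "0 < y" by linarith
  then show ?thesis
  proof cases
    case 1
    then show ?thesis
      using powr_diff_ge[of q x y M] assms by (auto simp: sgn_if)
  next
    case 2
    then show ?thesis
      using powr_diff_ge[of q "- y" "- x" M] assms by (auto simp: sgn_if)
  next
    case 3
    then show ?thesis
      using pos[of y] pos[of "- x"] assms by (simp add: right_diff_distrib)
  qed
qed

text \<open>The constant is half of the minimum over \<open>[-M, M]\<close> of the second derivative of \<open>\<bar>x\<bar> powr p\<close>.\<close>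

lemma abs_powr_bregman_ge:
  fixes a b p M :: real
  assumes "1 < p" "p \<le> 2" "\<bar>a\<bar> \<le> M" "\<bar>b\<bar> \<le> M"
  shows "p * (p - 1) / 2 * M powr (p - 2) * (b - a)\<^sup>2
    \<le> \<bar>b\<bar> powr p - \<bar>a\<bar> powr p - p * (sgn a * \<bar>a\<bar> powr (p - 1)) * (b - a)"
proof -
  define c where "c = (p - 1) * M powr (p - 2)"
  define f where "f x = sgn x * \<bar>x\<bar> powr (p - 1)" for x :: real
  \<comment> \<open>Subtracting a quadratic with second derivative \<open>p * c\<close> leaves
    \<open>h\<close> convex on \<open>[-M, M]\<close>, so it suffices to prove the tangent
    inequality for \<open>h\<close>.\<close>
  define h where "h x = \<bar>x\<bar> powr p - p * c / 2 * x\<^sup>2" for x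
  define h' where "h' x = p * (f x - c * x)" for x
  have deriv: "(h has_real_derivative h' x) (at x)" for x
    unfolding h_def h'_def f_def
    by (rule derivative_eq_intros has_real_derivative_abs_powr assms refl | simp add: algebra_simps)+
  have mono: "h' x \<le> h' y" if "x \<le> y" "\<bar>x\<bar> \<le> M" "\<bar>y\<bar> \<le> M" for x y
  proof -
    have "f x - c * x \<le> f y - c * y"
      using sgn_powr_diff_ge[of "p - 1" x y M] that assms
      by (simp add: f_def c_def right_diff_distrib)
    then show ?thesis
      using assms unfolding h'_def by (intro mult_left_mono) auto
  qed
  have "h' a * (b - a) \<le> h b - h a"
  proof (cases a b rule: linorder_cases)
    case less
    obtain z where z: "a < z" "z < b" "h b - h a = (b - a) * h' z"
      using MVT2[OF less deriv] by blast
    have "h' a \<le> h' z" using z assms by (intro mono) auto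
    then show ?thesis
      using z less by (simp add: mult.commute)
  next
    case greater
    obtain z where z: "b < z" "z < a" "h a - h b = (a - b) * h' z"
      using MVT2[OF greater deriv] by blast
    have "h' z \<le> h' a" using z assms by (intro mono) auto
    then have "(a - b) * h' z \<le> (a - b) * h' a"
      using greater by (intro mult_left_mono) auto
    then show ?thesis
      using z by (simp add: algebra_simps)
  qed simp
  \<comment> \<open>The gap between \<open>x\<^sup>2\<close> and its tangent at \<open>a\<close> is
    exactly \<open>(b - a)\<^sup>2\<close>, which restores the subtracted quadratic.\<close>
  moreover have "h b - h a - h' a * (b - a)
      = \<bar>b\<bar> powr p - \<bar>a\<bar> powr p - p * f a * (b - a) - p * c / 2 * (b - a)\<^sup>2"
    by (simp add: h_def h'_def power2_eq_square field_simps)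
  ultimately show ?thesis
    by (simp add: c_def f_def)
qed


section \<open>The penalty and its Bregman distance under the source condition\<close>

text \<open>Multiplying the source condition by \<open>ell2_nth v k\<close> turns the penalty terms
  into products of two square-summable sequences. This makes \<open>u_plus\<close> a competitor of
  finite Tikhonov value.\<close>

lemma source_penalty_summable:
  assumes "1 < p"
    and source: "\<And>k. w k * sgn (ell2_nth v k) * \<bar>ell2_nth v k\<bar> powr (p - 1) = ell2_nth \<xi> k"
  shows "summable (\<lambda>k. w k * \<bar>ell2_nth v k\<bar> powr p)"
proof -
  have "w k * \<bar>ell2_nth v k\<bar> powr p = ell2_nth \<xi> k * ell2_nth v k" for k
  proof -
    have "\<bar>ell2_nth v k\<bar> powr p = (sgn (ell2_nth v k) * ell2_nth v k) * \<bar>ell2_nth v k\<bar> powr (p - 1)"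
      using powr_mult_base[of "\<bar>ell2_nth v k\<bar>" "p - 1"] abs_sgn[of "ell2_nth v k"]
      by (simp add: mult.commute)
    then show ?thesis
      by (simp flip: source)
  qed
  then show ?thesis
    by (simp add: summable_ell2_nth_mult)
qed

text \<open>The scalar estimate is weighted by \<open>w k\<close> and summed; by
  \<open>source\<close>, the linear terms sum to an inner product with \<open>\<xi>\<close>. As
  \<open>w\<close> may be unbounded, summability of the weighted squares comes from comparison with
  the Bregman terms.\<close>

lemma penalty_bregman_ge:
  fixes M p :: real
  defines "c \<equiv> p * (p - 1) / 2 * M powr (p - 2)"
  assumes p: "1 < p" "p \<le> 2" and "0 < M"
    and w: "\<And>k. 0 \<le> w k"
    and source: "\<And>k. w k * sgn (ell2_nth v k) * \<bar>ell2_nth v k\<bar> powr (p - 1) = ell2_nth \<xi> k"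
    and sum: "summable (\<lambda>k. w k * \<bar>ell2_nth u k\<bar> powr p)"
    and bound: "\<And>k. \<bar>ell2_nth u k\<bar> \<le> M" "\<And>k. \<bar>ell2_nth v k\<bar> \<le> M"
  shows "summable (\<lambda>k. w k * \<bar>ell2_nth u k - ell2_nth v k\<bar>\<^sup>2)"
    and "c * (\<Sum>k. w k * \<bar>ell2_nth u k - ell2_nth v k\<bar>\<^sup>2)
      \<le> (\<Sum>k. w k * \<bar>ell2_nth u k\<bar> powr p) - (\<Sum>k. w k * \<bar>ell2_nth v k\<bar> powr p)
        - p * inner (u - v) \<xi>"
proof -
  let ?d = "\<lambda>k. w k * \<bar>ell2_nth u k\<bar> powr p - w k * \<bar>ell2_nth v k\<bar> powr p
    - p * (ell2_nth (u - v) k * ell2_nth \<xi> k)"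
  let ?e = "\<lambda>k. w k * \<bar>ell2_nth u k - ell2_nth v k\<bar>\<^sup>2"
  note sums = sum source_penalty_summable[OF p(1) source] summable_ell2_nth_mult
  have c: "0 < c"
    using p \<open>0 < M\<close> by (simp add: c_def)
  have le: "c * ?e k \<le> ?d k" for k
  proof -
    let ?x = "ell2_nth u k" and ?y = "ell2_nth v k"
    have "w k * (c * (?x - ?y)\<^sup>2)
        \<le> w k * (\<bar>?x\<bar> powr p - \<bar>?y\<bar> powr p - p * (sgn ?y * \<bar>?y\<bar> powr (p - 1)) * (?x - ?y))"
      unfolding c_def by (intro mult_left_mono abs_powr_bregman_ge p bound w)
    also have "\<dots> = ?d k"
      unfolding source[symmetric] ell2_nth_diff by (simp only: right_diff_distrib mult_ac)
    finally show ?thesis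
      by (simp add: mult.left_commute)
  qed
  have sd: "summable ?d"
    by (intro summable_diff summable_mult sums)
  have "summable (\<lambda>k. c * ?e k)"
    using le w c by (intro summable_comparison_test'[OF sd, where N = 0]) auto
  then show se: "summable ?e"
    using c by simp
  have "c * (\<Sum>k. ?e k) = (\<Sum>k. c * ?e k)"
    by (rule suminf_mult[OF se, symmetric])
  also have "\<dots> \<le> (\<Sum>k. ?d k)"
    by (rule suminf_le[OF le summable_mult[OF se] sd])
  also have "\<dots> = (\<Sum>k. w k * \<bar>ell2_nth u k\<bar> powr p) - (\<Sum>k. w k * \<bar>ell2_nth v k\<bar> powr p)
        - p * inner (u - v) \<xi>"
    using suminf_diff[OF summable_diff[OF sums(1,2)] summable_mult[OF sums(3)], of p "u - v" \<xi>]
      suminf_diff[OF sums(1,2)] suminf_mult[OF sums(3), of p "u - v" \<xi>]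
    unfolding inner_ell2_def by linarith
  finally show "c * (\<Sum>k. ?e k)
      \<le> (\<Sum>k. w k * \<bar>ell2_nth u k\<bar> powr p) - (\<Sum>k. w k * \<bar>ell2_nth v k\<bar> powr p)
        - p * inner (u - v) \<xi>" .
qed

section \<open>Consequences of minimality\<close>

text \<open>A competitor of finite value rules out the infinite branch for \<open>u\<close>, so the
  comparison can be read in the reals.\<close>

lemma tikhonov_minimizer_le:
  assumes min: "is_arg_min (tikhonov K w p \<alpha> g) (\<lambda>_. True) u"
    and v: "summable (\<lambda>k. w k * \<bar>ell2_nth v k\<bar> powr p)"
  shows "summable (\<lambda>k. w k * \<bar>ell2_nth u k\<bar> powr p)"
    and "(norm (K u - g))\<^sup>2 + \<alpha> * (\<Sum>k. w k * \<bar>ell2_nth u k\<bar> powr p)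
      \<le> (norm (K v - g))\<^sup>2 + \<alpha> * (\<Sum>k. w k * \<bar>ell2_nth v k\<bar> powr p)"
proof -
  have "tikhonov K w p \<alpha> g u \<le> tikhonov K w p \<alpha> g v"
    using min by (auto simp: is_arg_min_linorder)
  then show "summable (\<lambda>k. w k * \<bar>ell2_nth u k\<bar> powr p)"
    and "(norm (K u - g))\<^sup>2 + \<alpha> * (\<Sum>k. w k * \<bar>ell2_nth u k\<bar> powr p)
      \<le> (norm (K v - g))\<^sup>2 + \<alpha> * (\<Sum>k. w k * \<bar>ell2_nth v k\<bar> powr p)"
    using v by (auto simp: tikhonov_def split: if_splits)
qed

text \<open>Each term of a nonnegative series is at most its sum; the lower bound on the weights
  makes the resulting bound uniform in \<open>k\<close>.\<close>

lemma penalty_imp_nth_bound: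
  fixes p w\<^sub>0 B :: real
  assumes "0 < p" "0 < w\<^sub>0" "\<And>k. w\<^sub>0 \<le> w k"
    and sum: "summable (\<lambda>k. w k * \<bar>ell2_nth u k\<bar> powr p)"
    and B: "(\<Sum>k. w k * \<bar>ell2_nth u k\<bar> powr p) \<le> B"
  shows "\<bar>ell2_nth u k\<bar> \<le> (B / w\<^sub>0) powr (1 / p)"
proof -
  have w: "0 \<le> w k" for k
    using assms(2) assms(3)[of k] by linarith
  have "w\<^sub>0 * \<bar>ell2_nth u k\<bar> powr p \<le> w k * \<bar>ell2_nth u k\<bar> powr p"
    using assms by (intro mult_right_mono) auto
  also have "\<dots> \<le> (\<Sum>k. w k * \<bar>ell2_nth u k\<bar> powr p)"
    using sum_le_suminf[OF sum, of "{k}"] w by simp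
  also note B
  finally have "\<bar>ell2_nth u k\<bar> powr p \<le> B / w\<^sub>0"
    using \<open>0 < w\<^sub>0\<close> by (simp add: field_simps)
  then have "(\<bar>ell2_nth u k\<bar> powr p) powr (1 / p) \<le> (B / w\<^sub>0) powr (1 / p)"
    using \<open>0 < p\<close> by (intro powr_mono2) auto
  then show ?thesis
    using \<open>0 < p\<close> by (simp add: powr_powr)
qed

text \<open>Adding \<open>\<alpha>\<close> times the Bregman estimate to the minimality inequality
  cancels both penalties. The remaining linear term moves to the data space through the adjoint,
  where inserting \<open>g\<close> splits \<open>K v - K u\<close> into noise and residual.\<close>

lemma tikhonov_source_estimate:
  fixes K :: "ell2 \<Rightarrow> 'y::real_inner" and M p \<alpha> \<delta> :: real
  defines "c \<equiv> p * (p - 1) / 2 * M powr (p - 2)"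
  assumes K: "bounded_linear K"
    and p: "1 < p" "p \<le> 2" and "0 < M" and w: "\<And>k. 0 \<le> w k"
    and source: "\<And>k. w k * sgn (ell2_nth v k) * \<bar>ell2_nth v k\<bar> powr (p - 1)
             = ell2_nth (adjoint K \<theta>) k"
    and noise: "norm (K v - g) \<le> \<delta>" and "0 < \<alpha>"
    and min: "is_arg_min (tikhonov K w p \<alpha> g) (\<lambda>_. True) u"
    and bound: "\<And>k. \<bar>ell2_nth u k\<bar> \<le> M" "\<And>k. \<bar>ell2_nth v k\<bar> \<le> M"
  shows "summable (\<lambda>k. w k * \<bar>ell2_nth u k - ell2_nth v k\<bar>\<^sup>2)"
    and "(norm (K u - g))\<^sup>2 + \<alpha> * (c * (\<Sum>k. w k * \<bar>ell2_nth u k - ell2_nth v k\<bar>\<^sup>2))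
      \<le> \<delta>\<^sup>2 + \<alpha> * (p * norm \<theta> * (norm (K u - g) + \<delta>))"
proof -
  let ?R = "\<lambda>u. \<Sum>k. w k * \<bar>ell2_nth u k\<bar> powr p"
  let ?S = "\<Sum>k. w k * \<bar>ell2_nth u k - ell2_nth v k\<bar>\<^sup>2"
  note minimal = tikhonov_minimizer_le[OF min source_penalty_summable[OF p(1) source]]
  note bregman = penalty_bregman_ge[OF p \<open>0 < M\<close> w source minimal(1) bound]
  show "summable (\<lambda>k. w k * \<bar>ell2_nth u k - ell2_nth v k\<bar>\<^sup>2)"
    by (rule bregman(1))
  have "(norm (K v - g))\<^sup>2 \<le> \<delta>\<^sup>2"
    using noise by (intro power_mono) auto
  moreover have "- inner (u - v) (adjoint K \<theta>) \<le> norm \<theta> * (norm (K u - g) + \<delta>)"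
  proof -
    have "- inner (u - v) (adjoint K \<theta>) = inner ((K v - g) - (K u - g)) \<theta>"
      by (simp add: ell2_adjoint_works[OF K] linear_diff[OF bounded_linear.linear[OF K]] inner_diff_left)
    also have "\<dots> \<le> norm ((K v - g) - (K u - g)) * norm \<theta>"
      by (rule norm_cauchy_schwarz)
    also have "\<dots> \<le> (norm (K u - g) + \<delta>) * norm \<theta>"
      using norm_triangle_ineq4[of "K v - g" "K u - g"] noise
      by (intro mult_right_mono) auto
    finally show ?thesis by (simp add: mult.commute)
  qed
  then have "p * - inner (u - v) (adjoint K \<theta>) \<le> p * (norm \<theta> * (norm (K u - g) + \<delta>))"
    using p by (intro mult_left_mono) auto
  then have "\<alpha> * (c * ?S) \<le> \<alpha> * (?R u - ?R v + p * (norm \<theta> * (norm (K u - g) + \<delta>)))"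
    using bregman(2) \<open>0 < \<alpha>\<close> unfolding c_def by (intro mult_left_mono) auto
  ultimately show "(norm (K u - g))\<^sup>2 + \<alpha> * (c * ?S)
      \<le> \<delta>\<^sup>2 + \<alpha> * (p * norm \<theta> * (norm (K u - g) + \<delta>))"
    using minimal(2) by (simp add: algebra_simps)
qed

section \<open>From the quadratic inequality to the rates\<close>

text \<open>If \<open>t > \<delta>\<close>, one factor \<open>\<delta>\<close> of the constant term
  can be replaced by \<open>t\<close>, and then \<open>t\<close> cancels; otherwise
  \<open>1 \<le> B\<close> suffices.\<close>

lemma square_le_linear_imp_le:
  fixes t A B \<delta> :: real
  assumes "0 \<le> A" "1 \<le> B" "0 < \<delta>" "t\<^sup>2 \<le> A * \<delta> * t + B * \<delta>\<^sup>2"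
  shows "t \<le> (A + B) * \<delta>"
proof (cases "t \<le> \<delta>")
  case True
  moreover have "1 * \<delta> \<le> (A + B) * \<delta>"
    using assms by (intro mult_right_mono) auto
  ultimately show ?thesis by linarith
next
  case False
  have "B * \<delta> * \<delta> \<le> B * \<delta> * t"
    using False assms by (intro mult_left_mono) auto
  then have "t * t \<le> (A + B) * \<delta> * t"
    using assms(4) by (simp add: algebra_simps power2_eq_square)
  then show ?thesis
    using False assms by simp
qed

theorem theorem3p1:
  fixes K :: "ell2 \<Rightarrow> 'y::{real_inner, complete_space}"
    and p w\<^sub>0 :: real and w :: "nat \<Rightarrow> real"
    and u_plus :: ell2 and g_plus \<theta> :: 'y
    and \<alpha> :: "real \<Rightarrow> real" and g\<^sub>\<delta> :: "real \<Rightarrow> 'y" and u\<^sub>\<delta> :: "real \<Rightarrow> ell2"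
  assumes "bounded_linear K"
    and "1 < p" and "p \<le> 2"
    and "0 < w\<^sub>0" and "\<And>k. w\<^sub>0 \<le> w k"
    and "K u_plus = g_plus"
    and source_condition:
      "\<And>k. w k * sgn (ell2_nth u_plus k) * \<bar>ell2_nth u_plus k\<bar> powr (p - 1)
             = ell2_nth (adjoint K \<theta>) k"
    and noise: "\<And>\<delta>. 0 < \<delta> \<Longrightarrow> norm (g_plus - g\<^sub>\<delta> \<delta>) \<le> \<delta>"
    and "\<And>\<delta>. 0 < \<delta> \<Longrightarrow> 0 < \<alpha> \<delta>"
    and parameter_choice: "\<alpha> \<in> \<Theta>[at_right 0](\<lambda>\<delta>. \<delta>)"
    and minimizer:
      "\<And>\<delta>. 0 < \<delta> \<Longrightarrow> is_arg_min (tikhonov K w p (\<alpha> \<delta>) (g\<^sub>\<delta> \<delta>)) (\<lambda>_. True) (u\<^sub>\<delta> \<delta>)"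
  shows "(\<lambda>\<delta>. norm (K (u\<^sub>\<delta> \<delta>) - g\<^sub>\<delta> \<delta>)) \<in> O[at_right 0](\<lambda>\<delta>. \<delta>)
    \<and> (\<forall>\<^sub>F \<delta> in at_right 0.
          summable (\<lambda>k. w k * \<bar>ell2_nth (u\<^sub>\<delta> \<delta>) k - ell2_nth u_plus k\<bar>\<^sup>2))
    \<and> (\<lambda>\<delta>. \<Sum>k. w k * \<bar>ell2_nth (u\<^sub>\<delta> \<delta>) k - ell2_nth u_plus k\<bar>\<^sup>2) \<in> O[at_right 0](\<lambda>\<delta>. \<delta>)"
proof -
  let ?R = "\<lambda>u. \<Sum>k. w k * \<bar>ell2_nth u k\<bar> powr p"
  let ?S = "\<lambda>\<delta>. \<Sum>k. w k * \<bar>ell2_nth (u\<^sub>\<delta> \<delta>) k - ell2_nth u_plus k\<bar>\<^sup>2"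
  let ?t = "\<lambda>\<delta>. norm (K (u\<^sub>\<delta> \<delta>) - g\<^sub>\<delta> \<delta>)"
  have w: "0 \<le> w k" for k
    using assms(4,5) less_le_trans less_imp_le by blast
  note sum_plus = source_penalty_summable[OF \<open>1 < p\<close> source_condition]
  obtain C where C: "0 < C" "\<forall>\<^sub>F \<delta> in at_right 0. norm (\<alpha> \<delta>) \<le> C * norm \<delta>"
    using bigthetaD1[OF parameter_choice] by (elim landau_o.bigE)
  obtain D where D: "0 < D" "\<forall>\<^sub>F \<delta> in at_right 0. norm \<delta> \<le> D * norm (\<alpha> \<delta>)"
    using bigthetaD2[OF parameter_choice] by (auto simp: bigomega_iff_bigo elim: landau_o.bigE)
  \<comment> \<open>\<open>D\<close> bounds \<open>\<delta>\<^sup>2 / \<alpha> \<delta>\<close> for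
    small \<open>\<delta>\<close>, so \<open>B\<close> bounds the penalties of both
    \<open>u\<^sub>\<delta> \<delta>\<close> and \<open>u_plus\<close>. As \<open>D > 0\<close>,
    \<open>M\<close> is positive even for \<open>u_plus = 0\<close>.\<close>
  define B where "B = D + ?R u_plus"
  define M where "M = (B / w\<^sub>0) powr (1 / p)"
  define c where "c = p * (p - 1) / 2 * M powr (p - 2)"
  define T where "T = p * norm \<theta>"
  \<comment> \<open>The two summands are the coefficients to which
    \<open>square_le_linear_imp_le\<close> is applied below.\<close>
  define A where "A = C * T + (1 + C * T)"
  have "0 \<le> ?R u_plus"
    using w by (intro suminf_nonneg sum_plus) auto
  then have M: "0 < M"
    using D(1) assms(4) by (simp add: M_def B_def)
  have c: "0 < c"
    using M assms(2) by (simp add: c_def)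
  have T: "0 \<le> T"
    using assms(2) by (simp add: T_def)
  have main: "\<forall>\<^sub>F \<delta> in at_right 0. ?t \<delta> \<le> A * \<delta>
      \<and> summable (\<lambda>k. w k * \<bar>ell2_nth (u\<^sub>\<delta> \<delta>) k - ell2_nth u_plus k\<bar>\<^sup>2)
      \<and> 0 \<le> ?S \<delta> \<and> ?S \<delta> \<le> (D + T * (A + 1)) / c * \<delta>"
    using C(2) D(2) eventually_at_right_real[OF zero_less_one]
  proof eventually_elim
    case (elim \<delta>)
    define a where "a = \<alpha> \<delta>"
    have \<delta>: "0 < \<delta>" "\<delta> < 1" and a: "0 < a"
      using elim assms(9) by (auto simp: a_def)
    have aC: "a \<le> C * \<delta>" and aD: "\<delta> \<le> D * a"
      using elim \<delta> a by (auto simp: a_def)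
    \<comment> \<open>The factor \<open>a\<close> is kept so that it can be cancelled twice: in the
      penalty bound, using \<open>\<delta> < 1\<close>, and in the final error bound.\<close>
    have \<delta>2: "\<delta>\<^sup>2 \<le> a * (D * \<delta>)"
      using mult_right_mono[OF aD, of \<delta>] \<delta> by (simp add: power2_eq_square mult_ac)
    have noise': "norm (K u_plus - g\<^sub>\<delta> \<delta>) \<le> \<delta>"
      using noise[OF \<delta>(1)] assms(6) by simp
    note min = minimizer[OF \<delta>(1), folded a_def]
    note minimal = tikhonov_minimizer_le[OF min sum_plus]
    have "(norm (K u_plus - g\<^sub>\<delta> \<delta>))\<^sup>2 \<le> \<delta>\<^sup>2"
      using noise' by (intro power_mono) auto
    also have "\<dots> \<le> a * D"
      using \<delta>2 mult_left_mono[of "D * \<delta>" D a] mult_left_le[of \<delta> D] \<delta> D(1) a by linarith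
    finally have "a * ?R (u\<^sub>\<delta> \<delta>) \<le> a * B"
      using minimal(2) zero_le_power2[of "?t \<delta>"] unfolding B_def distrib_left by linarith
    then have "?R (u\<^sub>\<delta> \<delta>) \<le> B"
      using a by simp
    then have bound: "\<bar>ell2_nth (u\<^sub>\<delta> \<delta>) k\<bar> \<le> M" "\<bar>ell2_nth u_plus k\<bar> \<le> M" for k
      unfolding M_def using assms(2,4,5) minimal(1) sum_plus D(1)
      by (auto simp: B_def intro!: penalty_imp_nth_bound[where w = w])
    have est: "summable (\<lambda>k. w k * \<bar>ell2_nth (u\<^sub>\<delta> \<delta>) k - ell2_nth u_plus k\<bar>\<^sup>2)"
        "(?t \<delta>)\<^sup>2 + a * (c * ?S \<delta>) \<le> \<delta>\<^sup>2 + a * (T * (?t \<delta> + \<delta>))"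
      using tikhonov_source_estimate[OF assms(1-3) M w source_condition noise' a min bound]
      unfolding c_def T_def by blast+
    have S: "0 \<le> ?S \<delta>"
      using w by (intro suminf_nonneg est(1)) auto
    \<comment> \<open>For the residual, the error term is dropped and \<open>a\<close> is replaced
      by \<open>C * \<delta>\<close>, leaving a quadratic inequality in
      \<open>?t \<delta>\<close>.\<close>
    have "a * (T * (?t \<delta> + \<delta>)) \<le> (C * \<delta>) * (T * (?t \<delta> + \<delta>))"
      using aC T \<delta> by (intro mult_right_mono) auto
    moreover have "0 \<le> a * (c * ?S \<delta>)"
      using a c S by simp
    ultimately have "(?t \<delta>)\<^sup>2 \<le> (C * T) * \<delta> * ?t \<delta> + (1 + C * T) * \<delta>\<^sup>2"
      using est(2) by (simp add: algebra_simps power2_eq_square)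
    then have t: "?t \<delta> \<le> A * \<delta>"
      unfolding A_def using C(1) T \<delta> by (intro square_le_linear_imp_le) auto
    \<comment> \<open>For the error, the squared residual is dropped instead; \<open>a\<close>
      remains a factor of every term, and dividing by it leaves order
      \<open>\<delta>\<close>.\<close>
    have "a * (c * ?S \<delta>) \<le> \<delta>\<^sup>2 + a * (T * (?t \<delta> + \<delta>))"
      using est(2) zero_le_power2[of "?t \<delta>"] by linarith
    also have "\<dots> \<le> a * (D * \<delta>) + a * (T * (A * \<delta> + \<delta>))"
      using \<delta>2 t T a by (intro add_mono mult_left_mono) auto
    finally have "a * (c * ?S \<delta>) \<le> a * ((D + T * (A + 1)) * \<delta>)"
      by (simp add: algebra_simps)
    then have "c * ?S \<delta> \<le> (D + T * (A + 1)) * \<delta>"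
      using a by (rule mult_left_le_imp_le)
    then have "?S \<delta> \<le> (D + T * (A + 1)) / c * \<delta>"
      using c by (simp add: field_simps)
    with t est(1) S show ?case by blast
  qed
  have "?t \<in> O[at_right 0](\<lambda>\<delta>. \<delta>)"
  proof (rule bigoI)
    show "\<forall>\<^sub>F \<delta> in at_right 0. norm (?t \<delta>) \<le> A * norm \<delta>"
      using main eventually_at_right_less[of 0] by eventually_elim auto
  qed
  moreover have "?S \<in> O[at_right 0](\<lambda>\<delta>. \<delta>)"
  proof (rule bigoI)
    show "\<forall>\<^sub>F \<delta> in at_right 0. norm (?S \<delta>) \<le> (D + T * (A + 1)) / c * norm \<delta>"
      using main eventually_at_right_less[of 0] by eventually_elim auto
  qed
  moreover have "\<forall>\<^sub>F \<delta> in at_right 0.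
      summable (\<lambda>k. w k * \<bar>ell2_nth (u\<^sub>\<delta> \<delta>) k - ell2_nth u_plus k\<bar>\<^sup>2)"
    using main by eventually_elim blast
  ultimately show ?thesis by blast
qed

end
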